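(* For every $\boldsymbol{x}\in\Delta^K$ the following minimax equality holds: $$\max_{i=1,\dots,n+1}\ \min_{v\in\mathbb{R}}\Psi^i(\boldsymbol{x},v)=\min_{\boldsymbol{v}\in\mathbb{R}^{n+1}}\ \max_{i=1,\dots,n+1}\Psi^i(\boldsymbol{x},v^i),$$ where $\boldsymbol{v}=(v^1,\dots,v^{n+1})$. In particular, for given $\mu\in\mathbb{R}$, the problem $$\min_{\boldsymbol{x}\in\Delta^K(\mu)}\ \max_{i=1,\dots,n+1}\ \min_{v\in\mathbb{R}}\Psi^i(\boldsymbol{x},v)$$ can be equivalently written as $$\min_{\boldsymbol{x}\in\Delta^K(\mu)}\ \min_{\boldsymbol{v}\in\mathbb{R}^{n+1}}\ \max_{i=1,\dots,n+1}\Psi^i(\boldsymbol{x},v^i).$$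
   Context: Let $(\Omega,\mathcal{F},\mathbb{P})$ be a probability space with expectation $\mathbb{E}$, let $K\ge 1$ be an integer, and let $R^1,\dots,R^K,Z\in L^1(\Omega,\mathcal{F},\mathbb{P})$ be real-valued random variables (relative asset returns, and liabilities as a fraction of the initial budget). Superscripts on $R^k,x^k,v^i,\Psi^i$ are indices, not powers. Let $n\in\mathbb{N}_0$, and let $0\le\alpha_1<\cdots<\alpha_{n+1}\le 1$ and $0<r_1<\cdots<r_n<r_{n+1}=1$, where $\alpha_1>0$ is implicit in the requirement that the functions $\Psi^i$ below, which contain the factor $1/\alpha_i$, be real-valued. Define $\Delta^K:=\{\boldsymbol{x}=(x^1,\dots,x^K)\in\mathbb{R}^K : x^k\ge 0 \text{ for all } k,\ \sum_{k=1}^K x^k=1\}$ and, for $\mu\in\mathbb{R}$, $\Delta^K(\mu):=\{\boldsymbol{x}\in\Delta^K : \sum_{k=1}^K x^k\,\mathbb{E}(R^k)\ge\mu\}$. For $i=1,\dots,n+1$ and $\boldsymbol{x}\in\Delta^K$ define the function $\Psi^i(\boldsymbol{x},\cdot):\mathbb{R}\to\mathbb{R}$ by $$\Psi^i(\boldsymbol{x},v):=\frac{1}{\alpha_i}\,\mathbb{E}\left(\max\left\{v-\sum_{k=1}^K x^kR^k+r_iZ,\,0\right\}\right)-v.$$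
   Formalization: The minima over v are read as infima, since for α_{n+1}=1 the minimum may not be attained; they are shown to be attained when α_i<1, and the joint minimum over the vector v is attained whenever all the inner minima are. *)

theory Defs
  imports "HOL-Probability.Probability"
begin

definition portfolios :: "(real ^ 'k) set" where
  "portfolios = {x. (\<forall>k. 0 \<le> x $ k) \<and> (\<Sum>k\<in>UNIV. x $ k) = 1}"

definition portfolios_with_return ::
    "'a measure \<Rightarrow> ('k \<Rightarrow> 'a \<Rightarrow> real) \<Rightarrow> real \<Rightarrow> (real ^ 'k) set" where
  "portfolios_with_return M R \<mu> =
     {x \<in> portfolios. \<mu> \<le> (\<Sum>k\<in>UNIV. x $ k * (LINT \<omega>|M. R k \<omega>))}"

definition Psi ::
    "'a measure \<Rightarrow> ('k \<Rightarrow> 'a \<Rightarrow> real) \<Rightarrow> ('a \<Rightarrow> real) \<Rightarrow> (nat \<Rightarrow> real) \<Rightarrow> (nat \<Rightarrow> real)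
      \<Rightarrow> nat \<Rightarrow> real ^ 'k \<Rightarrow> real \<Rightarrow> real" where
  "Psi M R Z \<alpha> r i x v =
     1 / \<alpha> i * (LINT \<omega>|M. max (v - (\<Sum>k\<in>UNIV. x $ k * R k \<omega>) + r i * Z \<omega>) 0) - v"

text \<open>
  The vectors of real numbers indexed by \<open>1, \<dots>, n + 1\<close>; extensionality makes this an exact
  copy of the (\<open>n + 1\<close>)-dimensional space.
\<close>

definition threshold_vectors :: "nat \<Rightarrow> (nat \<Rightarrow> real) set" where
  "threshold_vectors n = {1..n + 1} \<rightarrow>\<^sub>E UNIV"

definition max_Psi ::
    "'a measure \<Rightarrow> ('k \<Rightarrow> 'a \<Rightarrow> real) \<Rightarrow> ('a \<Rightarrow> real) \<Rightarrow> (nat \<Rightarrow> real) \<Rightarrow> (nat \<Rightarrow> real)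
      \<Rightarrow> nat \<Rightarrow> real ^ 'k \<Rightarrow> (nat \<Rightarrow> real) \<Rightarrow> real" where
  "max_Psi M R Z \<alpha> r n x v = (MAX i\<in>{1..n + 1}. Psi M R Z \<alpha> r i x (v i))"

text \<open>
  Optimal values are infima in the extended reals, as \<open>v \<mapsto> Psi M R Z \<alpha> r i x v\<close> need not attain its
  infimum if \<open>\<alpha> i = 1\<close>: the infimum is then the limit at infinity, and it is not attained if
  \<open>(\<Sum>k\<in>UNIV. x $ k * R k \<omega>) - r i * Z \<omega>\<close> is not essentially bounded above.
\<close>

definition max_min_Psi ::
    "'a measure \<Rightarrow> ('k \<Rightarrow> 'a \<Rightarrow> real) \<Rightarrow> ('a \<Rightarrow> real) \<Rightarrow> (nat \<Rightarrow> real) \<Rightarrow> (nat \<Rightarrow> real)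
      \<Rightarrow> nat \<Rightarrow> real ^ 'k \<Rightarrow> ereal" where
  "max_min_Psi M R Z \<alpha> r n x = (MAX i\<in>{1..n + 1}. INF v. ereal (Psi M R Z \<alpha> r i x v))"

definition min_max_Psi ::
    "'a measure \<Rightarrow> ('k \<Rightarrow> 'a \<Rightarrow> real) \<Rightarrow> ('a \<Rightarrow> real) \<Rightarrow> (nat \<Rightarrow> real) \<Rightarrow> (nat \<Rightarrow> real)
      \<Rightarrow> nat \<Rightarrow> real ^ 'k \<Rightarrow> ereal" where
  "min_max_Psi M R Z \<alpha> r n x = (INF v\<in>threshold_vectors n. ereal (max_Psi M R Z \<alpha> r n x v))"

definition minimizers :: "('b \<Rightarrow> 'c::ord) \<Rightarrow> 'b set \<Rightarrow> 'b set" where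
  "minimizers f S = {x. is_arg_min f (\<lambda>y. y \<in> S) x}"

end

theory Submission
  imports Defs
begin

text \<open>
  The objective is a maximum of functions that each depend on their own coordinate of \<open>v\<close>, so all
  of them can be brought near their infima simultaneously; this gives the minimax equality.
  Optimal portfolios exist because \<open>Psi\<close> is Lipschitz in \<open>x\<close> uniformly in \<open>v\<close>: the infimum over \<open>v\<close>
  is therefore continuous in \<open>x\<close> even where it is not attained, and the feasible set is compact.
\<close>

section \<open>Minimax over a product of copies of one domain\<close>

lemma Max_INF_eq_INF_Max:
  fixes F :: "'i \<Rightarrow> 'b \<Rightarrow> 'c::complete_linorder"
  assumes "finite I" "I \<noteq> {}"
  shows "(MAX i\<in>I. INF v. F i v) = (INF v\<in>I \<rightarrow>\<^sub>E UNIV. MAX i\<in>I. F i (v i))"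
proof (rule antisym)
  show "(MAX i\<in>I. INF v. F i v) \<le> (INF v\<in>I \<rightarrow>\<^sub>E UNIV. MAX i\<in>I. F i (v i))"
  proof (rule INF_greatest)
    fix v
    have "(INF w. F i w) \<le> (MAX i\<in>I. F i (v i))" if "i \<in> I" for i
      using that assms by (intro order_trans[OF INF_lower[of "v i"]] Max_ge) auto
    then show "(MAX i\<in>I. INF w. F i w) \<le> (MAX i\<in>I. F i (v i))"
      using assms by (intro Max.boundedI) auto
  qed
  show "(INF v\<in>I \<rightarrow>\<^sub>E UNIV. MAX i\<in>I. F i (v i)) \<le> (MAX i\<in>I. INF v. F i v)"
    (is "?rhs \<le> ?lhs")
  proof (rule ccontr)
    \<comment> \<open>Each inner infimum is then strictly below \<open>?rhs\<close>, so each index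
      \<open>i\<close> has its own point \<open>w i\<close> with value below it. As \<open>I\<close>
      is finite, the maximum over these values is still strictly below \<open>?rhs\<close>, although
      it is one of the terms of that infimum.\<close>
    assume "\<not> ?rhs \<le> ?lhs"
    then have "(INF w. F i w) < ?rhs" if "i \<in> I" for i
      using that assms by (auto simp: not_le)
    then have "\<exists>w. F i w < ?rhs" if "i \<in> I" for i
      using that by (auto simp: INF_less_iff)
    then obtain w where w: "\<And>i. i \<in> I \<Longrightarrow> F i (w i) < ?rhs"
      by metis
    have "?rhs \<le> (MAX i\<in>I. F i (restrict w I i))"
      by (rule INF_lower) auto
    also have "\<dots> < ?rhs"
      using assms w by (subst Max_less_iff) auto
    finally show False by simp
  qed
qed

lemma is_arg_min_linorder:
  fixes f :: "'b \<Rightarrow> 'c::linorder"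
  shows "is_arg_min f P x \<longleftrightarrow> P x \<and> (\<forall>y. P y \<longrightarrow> f x \<le> f y)"
  by (auto simp: is_arg_min_def not_less)

lemma minimizers_cong:
  assumes "\<And>x. x \<in> S \<Longrightarrow> f x = g x"
  shows "minimizers f S = minimizers g S"
  using assms by (auto simp: minimizers_def is_arg_min_def)

section \<open>Growth, regularity and minimizers of \<open>Psi\<close> at a single index\<close>

context prob_space
begin

text \<open>Integrates the 1-Lipschitz bound for the positive part; the constant keeps its value
  because the total mass is 1. Taking \<open>Y = Y'\<close> gives continuity in \<open>v\<close>,
  taking \<open>v = w\<close> gives the estimate between portfolios.\<close>

lemma expected_shortfall_le:
  fixes Y Y' :: "'a \<Rightarrow> real"
  assumes [simp]: "integrable M Y" "integrable M Y'"
  shows "(LINT \<omega>|M. max (v - Y \<omega>) 0)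
    \<le> (LINT \<omega>|M. max (w - Y' \<omega>) 0) + \<bar>v - w\<bar> + (LINT \<omega>|M. \<bar>Y \<omega> - Y' \<omega>\<bar>)"
proof -
  have "(LINT \<omega>|M. max (v - Y \<omega>) 0)
      \<le> (LINT \<omega>|M. max (w - Y' \<omega>) 0 + \<bar>v - w\<bar> + \<bar>Y \<omega> - Y' \<omega>\<bar>)"
    by (rule integral_mono) auto
  also have "\<dots> = (LINT \<omega>|M. max (w - Y' \<omega>) 0) + \<bar>v - w\<bar> + (LINT \<omega>|M. \<bar>Y \<omega> - Y' \<omega>\<bar>)"
    by (simp add: prob_space)
  finally show ?thesis .
qed

lemma expected_shortfall_ge:
  fixes Y :: "'a \<Rightarrow> real"
  assumes [simp]: "integrable M Y"
  shows "v - expectation Y \<le> (LINT \<omega>|M. max (v - Y \<omega>) 0)"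
proof -
  have "v - expectation Y = (LINT \<omega>|M. v - Y \<omega>)"
    by (simp add: prob_space)
  also have "\<dots> \<le> (LINT \<omega>|M. max (v - Y \<omega>) 0)"
    by (rule integral_mono) auto
  finally show ?thesis .
qed

context
  fixes R :: "'k::finite \<Rightarrow> 'a \<Rightarrow> real" and Z :: "'a \<Rightarrow> real" and \<alpha> r :: "nat \<Rightarrow> real" and i :: nat
  assumes R [simp]: "\<And>k. integrable M (R k)" and Z [simp]: "integrable M Z"
    and \<alpha>: "0 < \<alpha> i" "\<alpha> i \<le> 1"
begin

text \<open>The portfolio return net of the scaled liability. In terms of it \<open>Psi\<close> is
  the Rockafellar-Uryasev objective, whose infimum over \<open>v\<close> is the expected shortfall
  at level \<open>\<alpha> i\<close>.\<close>

definition surplus :: "real ^ 'k \<Rightarrow> 'a \<Rightarrow> real" where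
  "surplus x \<omega> = (\<Sum>k\<in>UNIV. x $ k * R k \<omega>) - r i * Z \<omega>"

lemma integrable_surplus [simp]: "integrable M (surplus x)"
  unfolding surplus_def by simp

lemma Psi_surplus: "Psi M R Z \<alpha> r i x v = 1 / \<alpha> i * (LINT \<omega>|M. max (v - surplus x \<omega>) 0) - v"
  by (simp add: Psi_def surplus_def algebra_simps)

text \<open>Uses only that positive parts have nonnegative integral; controls \<open>v\<close>
  towards minus infinity.\<close>

lemma Psi_ge_uminus: "- v \<le> Psi M R Z \<alpha> r i x v"
  using \<alpha> by (simp add: Psi_surplus integral_nonneg_AE)

text \<open>Replaces the positive part by its argument. The slope is nonnegative, and positive
  exactly when \<open>\<alpha> i < 1\<close>; only then does this force growth towards plus
  infinity.\<close>

lemma Psi_ge_linear: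
  "(1 / \<alpha> i - 1) * v - expectation (surplus x) / \<alpha> i \<le> Psi M R Z \<alpha> r i x v"
proof -
  have "1 / \<alpha> i * (v - expectation (surplus x))
      \<le> 1 / \<alpha> i * (LINT \<omega>|M. max (v - surplus x \<omega>) 0)"
    using \<alpha> by (intro mult_left_mono expected_shortfall_ge) auto
  then show ?thesis
    by (simp add: Psi_surplus algebra_simps diff_divide_distrib)
qed

text \<open>Nonnegative \<open>v\<close> are handled by the linear bound, negative \<open>v\<close>
  by the bound \<open>- v\<close>; the absolute value makes the constant nonpositive, so that it
  serves both cases.\<close>

lemma Psi_bounded_below: "- \<bar>expectation (surplus x)\<bar> / \<alpha> i \<le> Psi M R Z \<alpha> r i x v"
proof (cases "0 \<le> v")
  case True
  have "- \<bar>expectation (surplus x)\<bar> / \<alpha> i \<le> - expectation (surplus x) / \<alpha> i"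
    using \<alpha> by (intro divide_right_mono) auto
  also have "\<dots> \<le> (1 / \<alpha> i - 1) * v - expectation (surplus x) / \<alpha> i"
    using \<alpha> True by simp
  also have "\<dots> \<le> Psi M R Z \<alpha> r i x v"
    by (rule Psi_ge_linear)
  finally show ?thesis .
next
  case False
  have "- \<bar>expectation (surplus x)\<bar> / \<alpha> i \<le> 0"
    using \<alpha> by (simp add: divide_nonpos_pos)
  with False Psi_ge_uminus[of v x] show ?thesis by linarith
qed

lemma bdd_below_Psi: "bdd_below (range (Psi M R Z \<alpha> r i x))"
  using Psi_bounded_below by (auto intro!: bdd_belowI2)

text \<open>The infimum lies between a real lower bound and the value at 0, hence is finite. This
  moves the problem to the reals, where Lipschitz estimates can be stated.\<close>

lemma ereal_INF_Psi: "(INF v. ereal (Psi M R Z \<alpha> r i x v)) = ereal (INF v. Psi M R Z \<alpha> r i x v)"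
proof -
  have "(INF v. ereal (Psi M R Z \<alpha> r i x v)) \<noteq> -\<infinity>"
    using INF_greatest[of UNIV "ereal (- \<bar>expectation (surplus x)\<bar> / \<alpha> i)" "\<lambda>v. ereal (Psi M R Z \<alpha> r i x v)"]
      Psi_bounded_below by auto
  moreover have "(INF v. ereal (Psi M R Z \<alpha> r i x v)) \<le> ereal (Psi M R Z \<alpha> r i x 0)"
    by (rule INF_lower) simp
  ultimately show ?thesis
    by (subst ereal_INF) auto
qed

text \<open>At a common threshold only the mean absolute difference of the surpluses remains: the
  liability cancels, and each coordinate of \<open>x - y\<close> is at most its norm. The constant
  is free of \<open>v\<close>, so the estimate survives the infimum over \<open>v\<close>.\<close>

lemma Psi_lipschitz_portfolio:
  "Psi M R Z \<alpha> r i x v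
    \<le> Psi M R Z \<alpha> r i y v + (1 / \<alpha> i * (\<Sum>k\<in>UNIV. LINT \<omega>|M. \<bar>R k \<omega>\<bar>)) * dist x y"
proof -
  have "(LINT \<omega>|M. \<bar>surplus x \<omega> - surplus y \<omega>\<bar>) \<le> (LINT \<omega>|M. (\<Sum>k\<in>UNIV. \<bar>R k \<omega>\<bar>) * dist x y)"
  proof (rule integral_mono)
    fix \<omega>
    have "\<bar>surplus x \<omega> - surplus y \<omega>\<bar> = \<bar>\<Sum>k\<in>UNIV. (x - y) $ k * R k \<omega>\<bar>"
      by (simp add: surplus_def sum_subtractf left_diff_distrib)
    also have "\<dots> \<le> (\<Sum>k\<in>UNIV. \<bar>(x - y) $ k\<bar> * \<bar>R k \<omega>\<bar>)"
      by (metis (no_types, lifting) abs_mult sum.cong sum_abs)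
    also have "\<dots> \<le> (\<Sum>k\<in>UNIV. norm (x - y) * \<bar>R k \<omega>\<bar>)"
      by (intro sum_mono mult_right_mono component_le_norm_cart) auto
    finally show "\<bar>surplus x \<omega> - surplus y \<omega>\<bar> \<le> (\<Sum>k\<in>UNIV. \<bar>R k \<omega>\<bar>) * dist x y"
      by (simp add: dist_norm sum_distrib_left mult.commute)
  qed auto
  also have "\<dots> = (\<Sum>k\<in>UNIV. LINT \<omega>|M. \<bar>R k \<omega>\<bar>) * dist x y"
    by simp
  finally have "(LINT \<omega>|M. max (v - surplus x \<omega>) 0)
      \<le> (LINT \<omega>|M. max (v - surplus y \<omega>) 0) + (\<Sum>k\<in>UNIV. LINT \<omega>|M. \<bar>R k \<omega>\<bar>) * dist x y"
    using expected_shortfall_le[of "surplus x" "surplus y" v v] by simp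
  from mult_left_mono[OF this, of "1 / \<alpha> i"] show ?thesis
    using \<alpha> by (simp add: Psi_surplus distrib_left add_divide_distrib)
qed

lemma INF_Psi_lipschitz:
  "(INF v. Psi M R Z \<alpha> r i x v)
    \<le> (INF v. Psi M R Z \<alpha> r i y v) + (1 / \<alpha> i * (\<Sum>k\<in>UNIV. LINT \<omega>|M. \<bar>R k \<omega>\<bar>)) * dist x y"
    (is "?L \<le> _ + ?c")
proof -
  have "?L - ?c \<le> Psi M R Z \<alpha> r i y v" for v
    using cINF_lower[OF bdd_below_Psi[of x], of v] Psi_lipschitz_portfolio[of x v y] by simp
  then have "?L - ?c \<le> (INF v. Psi M R Z \<alpha> r i y v)"
    by (intro cINF_greatest) auto
  then show ?thesis by simp
qed

lemma Psi_continuous: "continuous_on A (Psi M R Z \<alpha> r i x)"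
proof -
  have le: "(LINT \<omega>|M. max (v - surplus x \<omega>) 0) \<le> (LINT \<omega>|M. max (w - surplus x \<omega>) 0) + \<bar>v - w\<bar>"
    for v w
    using expected_shortfall_le[of "surplus x" "surplus x" v w] by simp
  have "1-lipschitz_on A (\<lambda>v. LINT \<omega>|M. max (v - surplus x \<omega>) 0)"
  proof (rule lipschitz_onI)
    fix v w
    show "dist (LINT \<omega>|M. max (v - surplus x \<omega>) 0) (LINT \<omega>|M. max (w - surplus x \<omega>) 0)
        \<le> 1 * dist v w"
      using le[of v w] le[of w v] by (simp add: dist_real_def)
  qed simp
  then have "continuous_on A (\<lambda>v. LINT \<omega>|M. max (v - surplus x \<omega>) 0)"
    by (rule lipschitz_on_continuous_on)
  then show ?thesis
    unfolding Psi_surplus by (intro continuous_intros)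
qed

lemma Psi_attains_min:
  assumes "\<alpha> i < 1"
  shows "minimizers (Psi M R Z \<alpha> r i x) UNIV \<noteq> {}"
proof -
  let ?P = "Psi M R Z \<alpha> r i x"
  define e where "e = expectation (surplus x)"
  \<comment> \<open>Outside \<open>{-B..B}\<close> the function is at least \<open>?P 0\<close>: the
    first entry of the maximum secures this on the left through the bound \<open>- v\<close>, the
    second on the right by solving the linear bound for \<open>w\<close>. Also \<open>B\<close> is
    nonnegative, so the interval contains 0.\<close>
  define B where "B = max \<bar>?P 0\<bar> ((\<bar>?P 0\<bar> + e / \<alpha> i) / (1 / \<alpha> i - 1))"
  have pos: "0 < 1 / \<alpha> i - 1"
    using \<alpha> assms by simp
  obtain v where v: "v \<in> {-B..B}" "\<And>w. w \<in> {-B..B} \<Longrightarrow> ?P v \<le> ?P w"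
    using continuous_attains_inf[of "{-B..B}" ?P] Psi_continuous by (force simp: B_def)
  have "?P v \<le> ?P w" for w
  proof (cases "w \<in> {-B..B}")
    case False
    have "?P 0 \<le> ?P w"
    proof (cases "w < -B")
      case True
      then show ?thesis
        using Psi_ge_uminus[of w x] by (simp add: B_def)
    next
      case False
      with \<open>w \<notin> {-B..B}\<close> have "(\<bar>?P 0\<bar> + e / \<alpha> i) / (1 / \<alpha> i - 1) < w"
        by (auto simp: B_def)
      then have "\<bar>?P 0\<bar> + e / \<alpha> i < (1 / \<alpha> i - 1) * w"
        using pos by (simp add: pos_divide_less_eq mult.commute)
      then show ?thesis
        using Psi_ge_linear[of w x] by (simp add: e_def)
    qed
    moreover have "?P v \<le> ?P 0"
      by (rule v) (auto simp: B_def)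
    ultimately show ?thesis by simp
  qed (rule v)
  then show ?thesis
    by (auto simp: minimizers_def is_arg_min_linorder)
qed

end

end

section \<open>Compactness of the feasible set, and passage from one index to the maximum\<close>

lemma compact_portfolios_with_return:
  "compact (portfolios_with_return M (R :: 'k::finite \<Rightarrow> 'a \<Rightarrow> real) \<mu>)"
proof -
  \<comment> \<open>A single nonnegative weight cannot exceed the total 1, so portfolios lie in the
    unit cube.\<close>
  have "x $ k \<le> 1" if "x \<in> portfolios" for x :: "real ^ 'k" and k
    using that member_le_sum[of k UNIV "\<lambda>k. x $ k"] by (auto simp: portfolios_def)
  then have "portfolios_with_return M R \<mu> \<subseteq> cbox 0 1"
    by (auto simp: portfolios_with_return_def portfolios_def mem_box_cart)
  then have "bounded (portfolios_with_return M R \<mu>)"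
    by (rule bounded_subset[OF bounded_cbox])
  moreover have "closed (portfolios_with_return M R \<mu>)"
    unfolding portfolios_with_return_def portfolios_def mem_Collect_eq
    by (intro closed_Collect_conj closed_Collect_all closed_Collect_le closed_Collect_eq
        continuous_intros)
  ultimately show ?thesis
    by (simp add: compact_eq_bounded_closed)
qed

lemma max_min_Psi_eq_min_max_Psi: "max_min_Psi M R Z \<alpha> r n x = min_max_Psi M R Z \<alpha> r n x"
proof -
  \<comment> \<open>The embedding \<open>ereal\<close> is monotone, hence commutes with the maximum
    over a finite nonempty index set.\<close>
  have "ereal (max_Psi M R Z \<alpha> r n x v) = (MAX i\<in>{1..n + 1}. ereal (Psi M R Z \<alpha> r i x (v i)))" for v
    unfolding max_Psi_def
    by (subst mono_Max_commute) (auto simp: mono_def image_image)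
  then show ?thesis
    unfolding max_min_Psi_def min_max_Psi_def threshold_vectors_def
    by (subst Max_INF_eq_INF_Max) auto
qed

text \<open>The coordinates decouple: minimizers chosen index by index form a vector that minimizes
  every term at once, hence also the maximum. Restricting it to the index range makes it extensional
  without changing any term.\<close>

lemma max_Psi_attains_min:
  assumes "\<forall>i\<in>{1..n + 1}. minimizers (Psi M R Z \<alpha> r i x) UNIV \<noteq> {}"
  shows "minimizers (max_Psi M R Z \<alpha> r n x) (threshold_vectors n) \<noteq> {}"
proof -
  have "\<forall>i\<in>{1..n + 1}. \<exists>v. \<forall>w. Psi M R Z \<alpha> r i x v \<le> Psi M R Z \<alpha> r i x w"
    using assms by (auto simp: minimizers_def is_arg_min_linorder)
  then obtain v where v: "\<And>i w. i \<in> {1..n + 1} \<Longrightarrow> Psi M R Z \<alpha> r i x (v i) \<le> Psi M R Z \<alpha> r i x w"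
    by metis
  have "max_Psi M R Z \<alpha> r n x (restrict v {1..n + 1}) \<le> max_Psi M R Z \<alpha> r n x w" for w
    unfolding max_Psi_def
  proof (rule Max.boundedI)
    fix a assume "a \<in> (\<lambda>i. Psi M R Z \<alpha> r i x (restrict v {1..n + 1} i)) ` {1..n + 1}"
    then obtain i where i: "i \<in> {1..n + 1}" "a = Psi M R Z \<alpha> r i x (v i)"
      by auto
    then have "a \<le> Psi M R Z \<alpha> r i x (w i)"
      using v by simp
    also have "\<dots> \<le> (MAX i\<in>{1..n + 1}. Psi M R Z \<alpha> r i x (w i))"
      using i by (intro Max_ge) auto
    finally show "a \<le> (MAX i\<in>{1..n + 1}. Psi M R Z \<alpha> r i x (w i))" .
  qed auto
  moreover have "restrict v {1..n + 1} \<in> threshold_vectors n"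
    by (auto simp: threshold_vectors_def)
  ultimately show ?thesis
    unfolding minimizers_def is_arg_min_linorder by blast
qed

lemma (in prob_space) max_min_Psi_attains_min:
  fixes R :: "'k::finite \<Rightarrow> 'a \<Rightarrow> real"
  assumes R: "\<And>k. integrable M (R k)" and Z: "integrable M Z"
    and \<alpha>: "\<And>i. i \<in> {1..n + 1} \<Longrightarrow> 0 < \<alpha> i" "\<And>i. i \<in> {1..n + 1} \<Longrightarrow> \<alpha> i \<le> 1"
    and S: "compact S" "S \<noteq> {}"
  shows "minimizers (max_min_Psi M R Z \<alpha> r n) S \<noteq> {}"
proof -
  define g where "g x i = (INF v. Psi M R Z \<alpha> r i x v)" for x i
  define L where "L i = 1 / \<alpha> i * (\<Sum>k\<in>UNIV. LINT \<omega>|M. \<bar>R k \<omega>\<bar>)" for i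
  \<comment> \<open>The Lipschitz constants \<open>L i\<close> are nonnegative, so their sum
    dominates each of them and serves as a Lipschitz constant for the maximum
    \<open>G\<close>.\<close>
  define C where "C = (\<Sum>i\<in>{1..n + 1}. L i)"
  define G where "G x = (MAX i\<in>{1..n + 1}. g x i)" for x
  \<comment> \<open>All inner infima are finite, so the extended-real objective is the real function
    \<open>G\<close>, to which the extreme value theorem applies.\<close>
  have eq: "max_min_Psi M R Z \<alpha> r n x = ereal (G x)" for x
  proof -
    have "max_min_Psi M R Z \<alpha> r n x = (MAX i\<in>{1..n + 1}. ereal (g x i))"
      unfolding max_min_Psi_def g_def using R Z \<alpha>
      by (intro arg_cong[where f = Max] image_cong refl ereal_INF_Psi) auto
    also have "\<dots> = ereal (G x)"
      unfolding G_def by (subst mono_Max_commute) (auto simp: mono_def image_image)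
    finally show ?thesis .
  qed
  have L: "0 \<le> L i" if "i \<in> {1..n + 1}" for i
    using \<alpha>(1)[OF that] by (simp add: L_def sum_nonneg)
  then have C: "0 \<le> C"
    unfolding C_def by (rule sum_nonneg)
  have le: "G x \<le> G y + C * dist x y" for x y
    unfolding G_def
  proof (rule Max.boundedI)
    fix a assume "a \<in> g x ` {1..n + 1}"
    then obtain i where i: "i \<in> {1..n + 1}" "a = g x i"
      by auto
    then have "a \<le> g y i + L i * dist x y"
      unfolding g_def L_def using R Z \<alpha> by (simp only:) (rule INF_Psi_lipschitz, auto)
    also have "\<dots> \<le> (MAX i\<in>{1..n + 1}. g y i) + C * dist x y"
      unfolding C_def using i L by (intro add_mono Max_ge mult_right_mono member_le_sum) auto
    finally show "a \<le> (MAX i\<in>{1..n + 1}. g y i) + C * dist x y" .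
  qed auto
  have "C-lipschitz_on S G"
  proof (rule lipschitz_onI)
    fix x y
    show "dist (G x) (G y) \<le> C * dist x y"
      using le[of x y] le[of y x] by (simp add: dist_real_def dist_commute)
  qed (rule C)
  then have "continuous_on S G"
    by (rule lipschitz_on_continuous_on)
  then obtain x where "x \<in> S" "\<And>y. y \<in> S \<Longrightarrow> G x \<le> G y"
    using continuous_attains_inf[OF S] by blast
  then show ?thesis
    by (auto simp: minimizers_def is_arg_min_linorder eq)
qed

theorem theorem1:
  fixes M :: "'a measure"
    and R :: "'k::finite \<Rightarrow> 'a \<Rightarrow> real"
    and Z :: "'a \<Rightarrow> real"
    and n :: nat
    and \<alpha> r :: "nat \<Rightarrow> real"
  assumes "prob_space M"
    and "\<And>k. integrable M (R k)"
    and "integrable M Z"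
    and "0 < \<alpha> 1" and "strict_mono_on {1..n + 1} \<alpha>" and "\<alpha> (n + 1) \<le> 1"
    and "0 < r 1" and "strict_mono_on {1..n + 1} r" and "r (n + 1) = 1"
  shows "(\<forall>x\<in>portfolios.
            max_min_Psi M R Z \<alpha> r n x = min_max_Psi M R Z \<alpha> r n x
          \<and> (\<forall>i\<in>{1..n + 1}. (INF v. ereal (Psi M R Z \<alpha> r i x v)) \<noteq> -\<infinity>)
          \<and> (\<forall>i\<in>{1..n + 1}. \<alpha> i < 1 \<longrightarrow> minimizers (Psi M R Z \<alpha> r i x) UNIV \<noteq> {})
          \<and> ((\<forall>i\<in>{1..n + 1}. minimizers (Psi M R Z \<alpha> r i x) UNIV \<noteq> {}) \<longrightarrow>
               minimizers (max_Psi M R Z \<alpha> r n x) (threshold_vectors n) \<noteq> {}))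
       \<and> (\<forall>\<mu>.
            (INF x\<in>portfolios_with_return M R \<mu>. max_min_Psi M R Z \<alpha> r n x)
              = (INF x\<in>portfolios_with_return M R \<mu>. min_max_Psi M R Z \<alpha> r n x)
          \<and> minimizers (max_min_Psi M R Z \<alpha> r n) (portfolios_with_return M R \<mu>)
              = minimizers (min_max_Psi M R Z \<alpha> r n) (portfolios_with_return M R \<mu>)
          \<and> (portfolios_with_return M R \<mu> \<noteq> {} \<longrightarrow>
               minimizers (max_min_Psi M R Z \<alpha> r n) (portfolios_with_return M R \<mu>) \<noteq> {}))"
proof -
  interpret prob_space M by fact
  have \<alpha>: "0 < \<alpha> i" "\<alpha> i \<le> 1" if "i \<in> {1..n + 1}" for i
  proof -
    \<comment> \<open>Comparison with the first and last index carries the bounds assumed there over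
      to every \<open>\<alpha> i\<close>.\<close>
    have mono: "\<alpha> j \<le> \<alpha> k" if "j \<in> {1..n + 1}" "k \<in> {1..n + 1}" "j \<le> k" for j k
      using mono_onD[OF strict_mono_on_imp_mono_on[OF assms(5)]] that by blast
    show "0 < \<alpha> i" "\<alpha> i \<le> 1"
      using mono[of 1 i] mono[of i "n + 1"] that assms(4,6) by auto
  qed
  have "(INF v. ereal (Psi M R Z \<alpha> r i x v)) \<noteq> -\<infinity>" if "i \<in> {1..n + 1}" for i x
    using that \<alpha> assms(2,3) by (subst ereal_INF_Psi) auto
  moreover have "minimizers (Psi M R Z \<alpha> r i x) UNIV \<noteq> {}" if "i \<in> {1..n + 1}" "\<alpha> i < 1" for i x
    using that \<alpha> assms(2,3) by (intro Psi_attains_min) auto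
  moreover have "minimizers (max_min_Psi M R Z \<alpha> r n) (portfolios_with_return M R \<mu>) \<noteq> {}"
    if "portfolios_with_return M R \<mu> \<noteq> {}" for \<mu>
    using that \<alpha> assms(2,3)
    by (intro max_min_Psi_attains_min compact_portfolios_with_return) auto
  \<comment> \<open>The two objectives agree pointwise, so the outer problems share their minimizers
    as well as their optimal value.\<close>
  moreover have "minimizers (max_min_Psi M R Z \<alpha> r n) (portfolios_with_return M R \<mu>)
      = minimizers (min_max_Psi M R Z \<alpha> r n) (portfolios_with_return M R \<mu>)" for \<mu>
    by (intro minimizers_cong max_min_Psi_eq_min_max_Psi)
  ultimately show ?thesis
    using max_min_Psi_eq_min_max_Psi[of M R Z \<alpha> r n] max_Psi_attains_min[of n M R Z \<alpha> r]
    by simp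
qed

end
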